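(* Let $B\geq 2$ and let $a_1,\dots,a_r\geq 0$ be integers. Then $$s_B\left( \sum_{i=1}^{r} a_i \right)=\sum_{i=1}^{r }s_B(a_i)- \widehat{c}_B\left( a_1,a_2,\dots,a_r \right),$$ where $\widehat{c}_B(a_1,\dots,a_r):=\beta-s_B(\beta)+(B-1)c_B(a_1,\dots,a_r)$.
   Context: For an integer $a\geq 0$, $s_B(a)$ is the sum of its base-$B$ digits ($s_B(0)=0$). Write each $a_i=\sum_{j\ge 0}\alpha_{i,j}B^j$ with digits $0\le \alpha_{i,j}<B$, and let $t\ge 0$ be the largest exponent $j$ such that some $\alpha_{i,j}\neq 0$ (take $t=0$ if all $a_i=0$). The carries of the traditional base-$B$ column addition algorithm for $a_1+\dots+a_r$ are $\delta_0=\lfloor(\alpha_{1,0}+\dots+\alpha_{r,0})/B\rfloor$ and $\delta_j=\lfloor(\alpha_{1,j}+\dots+\alpha_{r,j}+\delta_{j-1})/B\rfloor$ for $1\le j\le t$. The carry sum is $c_B(a_1,\dots,a_r)=\sum_{j=0}^{t}\delta_j$ and the terminal carry (the carry left over from the left-most column, which is brought down to form the left-most digits of the sum) is $\beta=\delta_t$. *)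

theory Defs
  imports Main
begin

definition digit :: "nat \<Rightarrow> nat \<Rightarrow> nat \<Rightarrow> nat" where
  "digit B a j = (a div B ^ j) mod B"

text \<open>The next three facts show that, for \<open>B \<ge> 2\<close>, the numbers \<open>digit B a j\<close> are the
  base-\<open>B\<close> digits of \<open>a\<close>, and that the sum and the maximum below range over finite sets.\<close>

lemma digit_less: "2 \<le> B \<Longrightarrow> digit B a j < B"
  by (simp add: digit_def)

lemma finite_digit_support:
  assumes "2 \<le> B"
  shows "finite {j. digit B a j \<noteq> 0}"
proof (rule finite_subset)
  show "{j. digit B a j \<noteq> 0} \<subseteq> {..a}"
  proof
    fix j assume "j \<in> {j. digit B a j \<noteq> 0}"
    then have "B ^ j \<le> a"
      unfolding digit_def by (metis (mono_tags) div_less mem_Collect_eq mod_0 not_le)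
    moreover have "j < B ^ j"
      using assms by (intro power_gt_expt) simp
    ultimately show "j \<in> {..a}" by simp
  qed
qed simp

lemma digit_expansion:
  assumes "2 \<le> B"
  shows "a = (\<Sum>j | digit B a j \<noteq> 0. digit B a j * B ^ j)"
proof -
  have split: "a = (\<Sum>j<n. digit B a j * B ^ j) + B ^ n * (a div B ^ n)" for n
  proof (induction n)
    case (Suc n)
    have "a div B ^ n = B * (a div B ^ Suc n) + digit B a n"
      by (simp add: digit_def div_mult2_eq mult.commute[of B])
    then have "B ^ n * (a div B ^ n) = B ^ Suc n * (a div B ^ Suc n) + digit B a n * B ^ n"
      by (simp add: algebra_simps)
    with Suc show ?case by simp
  qed simp
  obtain n where n: "a < B ^ n" "{j. digit B a j \<noteq> 0} \<subseteq> {..<n}"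
  proof -
    obtain m where m: "{j. digit B a j \<noteq> 0} \<subseteq> {..<m}"
      using finite_digit_support[OF assms, of a] unfolding finite_nat_set_iff_bounded by blast
    have "a + m < B ^ (a + m)"
      using assms by (intro power_gt_expt) simp
    with m that[of "a + m"] show thesis by fastforce
  qed
  have "a = (\<Sum>j<n. digit B a j * B ^ j)"
    using split[of n] n(1) by simp
  also have "\<dots> = (\<Sum>j | digit B a j \<noteq> 0. digit B a j * B ^ j)"
    using n(2) by (intro sum.mono_neutral_right) auto
  finally show ?thesis .
qed

definition digit_sum :: "nat \<Rightarrow> nat \<Rightarrow> nat" where
  "digit_sum B a = (\<Sum>j | digit B a j \<noteq> 0. digit B a j)"

text \<open>Throughout, a tuple \<open>a\<^sub>1, \<dots>, a\<^sub>r\<close> is given by its length \<open>r\<close> and a function \<open>a\<close>,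
  of which only the values on \<open>{1..r}\<close> matter.\<close>

definition top_exponent :: "nat \<Rightarrow> nat \<Rightarrow> (nat \<Rightarrow> nat) \<Rightarrow> nat" where
  "top_exponent B r a =
     (if \<forall>i\<in>{1..r}. a i = 0 then 0
      else Max {j. \<exists>i\<in>{1..r}. digit B (a i) j \<noteq> 0})"

primrec carry :: "nat \<Rightarrow> nat \<Rightarrow> (nat \<Rightarrow> nat) \<Rightarrow> nat \<Rightarrow> nat" where
  "carry B r a 0 = (\<Sum>i=1..r. digit B (a i) 0) div B"
| "carry B r a (Suc j) = ((\<Sum>i=1..r. digit B (a i) (Suc j)) + carry B r a j) div B"

definition carry_sum :: "nat \<Rightarrow> nat \<Rightarrow> (nat \<Rightarrow> nat) \<Rightarrow> nat" where
  "carry_sum B r a = (\<Sum>j=0..top_exponent B r a. carry B r a j)"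

definition terminal_carry :: "nat \<Rightarrow> nat \<Rightarrow> (nat \<Rightarrow> nat) \<Rightarrow> nat" where
  "terminal_carry B r a = carry B r a (top_exponent B r a)"

definition carry_hat :: "nat \<Rightarrow> nat \<Rightarrow> (nat \<Rightarrow> nat) \<Rightarrow> int" where
  "carry_hat B r a =
     int (terminal_carry B r a) - int (digit_sum B (terminal_carry B r a))
     + (int B - 1) * int (carry_sum B r a)"

end

theory Submission
  imports Defs
begin

text \<open>For a natural number \<open>a\<close>, the defect \<open>a - s\<^sub>B(a)\<close> is a sum of quotients: as in Legendre's
  formula, \<open>a - s\<^sub>B(a) = (B - 1) (\<lfloor>a / B\<rfloor> + \<dots> + \<lfloor>a / B\<^sup>n\<rfloor>) + (q - s\<^sub>B(q))\<close> with
  \<open>q = \<lfloor>a / B\<^sup>n\<rfloor>\<close>. The carry \<open>\<delta>\<^sub>j\<close> is the amount by which the quotient of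
  \<open>a\<^sub>1 + \<dots> + a\<^sub>r\<close> by \<open>B ^ (j + 1)\<close> exceeds the sum of the quotients of the \<open>a\<^sub>i\<close>. Subtracting
  Legendre's formula for the summands from that for their sum, with \<open>n = t + 1\<close>, the
  quotients leave \<open>(B - 1) (\<delta>\<^sub>0 + \<dots> + \<delta>\<^sub>t)\<close>, and the remaining term for the sum is
  \<open>\<beta> - s\<^sub>B(\<beta>)\<close> because \<open>\<lfloor>a\<^sub>i / B\<^sup>n\<rfloor> = 0\<close> for every \<open>i\<close>.\<close>

lemma div_power_Suc: "a div B ^ Suc n = a div B ^ n div B" for a B n :: nat
  by (simp add: div_mult2_eq power_Suc2 del: power_Suc)

lemma digit_0_right [simp]: "digit B a 0 = a mod B"
  by (simp add: digit_def)

lemma digit_of_0 [simp]: "digit B 0 j = 0"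
  by (simp add: digit_def)

lemma digit_div_power: "digit B (a div B ^ n) j = digit B a (n + j)"
  by (simp add: digit_def div_mult2_eq power_add)

lemma digit_Suc: "digit B a (Suc j) = digit B (a div B) j"
  using digit_div_power[of B a 1 j] by simp

lemma less_power_if_digits_eq_0:
  assumes "2 \<le> B" and "\<And>j. n \<le> j \<Longrightarrow> digit B a j = 0"
  shows "a < B ^ n"
proof -
  have "digit B (a div B ^ n) j = 0" for j
    by (simp add: digit_div_power assms(2))
  then have "a div B ^ n = 0"
    using digit_expansion[OF assms(1), of "a div B ^ n"] by simp
  then show ?thesis
    using assms(1) by (simp add: div_eq_0_iff)
qed

lemma digit_eq_0_if_top_exponent_less:
  assumes "2 \<le> B" and "i \<in> {1..r}" and "top_exponent B r a < j"
  shows "digit B (a i) j = 0"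
proof (cases "\<forall>i\<in>{1..r}. a i = 0")
  case True
  then show ?thesis using assms(2) by simp
next
  case False
  let ?J = "{j. \<exists>i\<in>{1..r}. digit B (a i) j \<noteq> 0}"
  have "?J = (\<Union>i\<in>{1..r}. {j. digit B (a i) j \<noteq> 0})"
    by auto
  then have "finite ?J"
    using finite_digit_support[OF assms(1)] by simp
  moreover have "Max ?J < j"
    using False assms(3) by (simp only: top_exponent_def if_False)
  ultimately have "j \<notin> ?J"
    by (meson Max_ge not_le)
  then show ?thesis using assms(2) by blast
qed

lemma less_power_Suc_top_exponent:
  assumes "2 \<le> B" and "i \<in> {1..r}"
  shows "a i < B ^ Suc (top_exponent B r a)"
proof (rule less_power_if_digits_eq_0[OF assms(1)])
  show "digit B (a i) j = 0" if "Suc (top_exponent B r a) \<le> j" for j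
    using digit_eq_0_if_top_exponent_less[OF assms] that by simp
qed

lemma digit_sum_rec:
  assumes "2 \<le> B"
  shows "digit_sum B a = a mod B + digit_sum B (a div B)"
proof -
  let ?H = "{j. digit B (a div B) j \<noteq> 0}"
  have finite_support: "finite ?H"
    using assms by (rule finite_digit_support)
  have "j \<in> insert 0 (Suc ` ?H)" if "digit B a j \<noteq> 0" for j
    using that by (cases j) (auto simp: digit_Suc)
  then have "digit_sum B a = (\<Sum>j\<in>insert 0 (Suc ` ?H). digit B a j)"
    unfolding digit_sum_def using finite_support by (intro sum.mono_neutral_left) auto
  also have "\<dots> = a mod B + (\<Sum>j\<in>?H. digit B a (Suc j))"
    using finite_support by (simp add: sum.reindex)
  finally show ?thesis
    by (simp add: digit_sum_def digit_Suc)
qed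

definition digit_defect :: "nat \<Rightarrow> nat \<Rightarrow> int" where
  "digit_defect B a = int a - int (digit_sum B a)"

lemma digit_defect_0 [simp]: "digit_defect B 0 = 0"
  by (simp add: digit_defect_def digit_sum_def)

lemma digit_defect_rec:
  assumes "2 \<le> B"
  shows "digit_defect B a = digit_defect B (a div B) + (int B - 1) * int (a div B)"
proof -
  have "int a = int B * int (a div B) + int (a mod B)"
    by (metis mult_div_mod_eq of_nat_add of_nat_mult)
  then show ?thesis
    by (simp add: digit_defect_def digit_sum_rec[OF assms, of a] left_diff_distrib)
qed

lemma digit_defect_eq_sum_div_power:
  assumes "2 \<le> B"
  shows "digit_defect B a
           = digit_defect B (a div B ^ n) + (int B - 1) * (\<Sum>j<n. int (a div B ^ Suc j))"
proof (induction n)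
  case 0
  show ?case by simp
next
  case (Suc n)
  have "digit_defect B (a div B ^ n)
      = digit_defect B (a div B ^ Suc n) + (int B - 1) * int (a div B ^ Suc n)"
    unfolding div_power_Suc by (rule digit_defect_rec[OF assms])
  with Suc.IH show ?case
    by (simp add: distrib_left del: power_Suc)
qed

lemma sum_div_power_eq_digits_plus:
  "(\<Sum>i\<in>I. a i div B ^ n) = (\<Sum>i\<in>I. digit B (a i) n) + B * (\<Sum>i\<in>I. a i div B ^ Suc n)"
proof -
  have "a i div B ^ n = digit B (a i) n + B * (a i div B ^ Suc n)" for i
    by (simp only: digit_def div_power_Suc mod_mult_div_eq)
  then show ?thesis
    by (simp only: sum.distrib sum_distrib_left)
qed

lemma sum_div_power_Suc_eq_plus_carry:
  assumes "0 < B"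
  shows "(\<Sum>i=1..r. a i) div B ^ Suc n = (\<Sum>i=1..r. a i div B ^ Suc n) + carry B r a n"
proof (induction n)
  case 0
  show ?case
    using sum_div_power_eq_digits_plus[of a B 0 "{1..r}"] assms by simp
next
  case (Suc n)
  let ?D = "\<Sum>i=1..r. digit B (a i) (Suc n)" and ?Q = "\<Sum>i=1..r. a i div B ^ Suc (Suc n)"
  have "(\<Sum>i=1..r. a i) div B ^ Suc (Suc n)
      = ((\<Sum>i=1..r. a i div B ^ Suc n) + carry B r a n) div B"
    by (simp only: div_power_Suc[of _ B "Suc n"] Suc.IH)
  also have "\<dots> = (?D + carry B r a n + B * ?Q) div B"
    by (simp only: sum_div_power_eq_digits_plus[of a B "Suc n"] ac_simps)
  also have "\<dots> = ?Q + carry B r a (Suc n)"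
    using assms by (simp del: power_Suc)
  finally show ?case .
qed

lemma digit_defect_sum:
  assumes "2 \<le> B" and bound: "\<And>i. i \<in> {1..r} \<Longrightarrow> a i < B ^ Suc n"
  shows "digit_defect B (\<Sum>i=1..r. a i)
           = (\<Sum>i=1..r. digit_defect B (a i)) + digit_defect B (carry B r a n)
             + (int B - 1) * (\<Sum>j\<le>n. int (carry B r a j))"
proof -
  let ?S = "\<Sum>i=1..r. a i"
  have quotient: "?S div B ^ Suc j = (\<Sum>i=1..r. a i div B ^ Suc j) + carry B r a j" for j
    using assms(1) by (intro sum_div_power_Suc_eq_plus_carry) simp
  have top_quotient: "?S div B ^ Suc n = carry B r a n"
    unfolding quotient using bound by (simp del: power_Suc)
  have "digit_defect B (a i) = (int B - 1) * (\<Sum>j\<le>n. int (a i div B ^ Suc j))"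
    if "i \<in> {1..r}" for i
    using digit_defect_eq_sum_div_power[OF assms(1), of "a i" "Suc n"] bound[OF that]
    by (simp only: div_less digit_defect_0 lessThan_Suc_atMost add_0)
  then have "(\<Sum>i=1..r. digit_defect B (a i))
      = (int B - 1) * (\<Sum>i=1..r. \<Sum>j\<le>n. int (a i div B ^ Suc j))"
    by (simp only: sum_distrib_left cong: sum.cong)
  also have "\<dots> = (int B - 1) * (\<Sum>j\<le>n. int (\<Sum>i=1..r. a i div B ^ Suc j))"
    by (subst sum.swap) (simp only: of_nat_sum)
  finally have summands: "(\<Sum>i=1..r. digit_defect B (a i))
      = (int B - 1) * (\<Sum>j\<le>n. int (\<Sum>i=1..r. a i div B ^ Suc j))" .
  have "digit_defect B ?S
      = digit_defect B (carry B r a n) + (int B - 1) * (\<Sum>j\<le>n. int (?S div B ^ Suc j))"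
    using digit_defect_eq_sum_div_power[OF assms(1), of ?S "Suc n"]
    by (simp only: top_quotient lessThan_Suc_atMost)
  then show ?thesis
    unfolding quotient summands by (simp only: of_nat_add sum.distrib distrib_left ac_simps)
qed

lemma carry_hat_eq_digit_defect:
  "carry_hat B r a = digit_defect B (terminal_carry B r a) + (int B - 1) * int (carry_sum B r a)"
  by (simp add: carry_hat_def digit_defect_def)

theorem theorem1p3:
  fixes B r :: nat and a :: "nat \<Rightarrow> nat"
  assumes "B \<ge> 2"
  shows "int (digit_sum B (\<Sum>i=1..r. a i))
           = (\<Sum>i=1..r. int (digit_sum B (a i))) - carry_hat B r a"
proof -
  have "digit_defect B (\<Sum>i=1..r. a i) = (\<Sum>i=1..r. digit_defect B (a i)) + carry_hat B r a"
    using digit_defect_sum[OF assms, of r a "top_exponent B r a"]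
      less_power_Suc_top_exponent[OF assms, of _ r a]
    by (simp add: carry_hat_eq_digit_defect terminal_carry_def carry_sum_def atMost_atLeast0
        del: power_Suc)
  then show ?thesis
    by (simp add: digit_defect_def sum_subtractf)
qed

end
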